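(* For every integer $k\ge0$, $x\lambda_k(x)=\binom{x}{k}$ is a polynomial of degree $k$ in $x$. The generating functions are, as formal power series in $u$ with coefficients polynomial in $x$, $$\sum_{k\ge0}x\,\lambda_k(x)\,u^k=(1+u)^x,\qquad \sum_{k\ge0}x\,\lambda_k(k+x)\,u^k=\frac{1}{(1-u)^x},$$ and the recurrence relation, for $k\ge1$, is $$(x+1)\lambda_k(x+1)=\binom{x+1}{k}=\binom{x}{k-1}+\binom{x}{k}=x\left[\lambda_{k-1}(x)+\lambda_k(x)\right],\qquad x\lambda_0(x)\equiv1.$$
   Context: Binomial coefficients are $\binom{y}{j}=y(y-1)\cdots(y-j+1)/j!$, and $x^{\underline{k+1}}=x(x-1)\cdots(x-k)$. The scaled Lah numbers are $\overline{l}(n,m)=\frac{n!}{m!}\binom{n-1}{m-1}$; for fixed $k\ge0$, $\overline{l}(n,n-k)$ is the value at $x=n$ of the polynomial $\overline{l}(x,x-k)=k!\binom{x}{k}\binom{x-1}{k}$. The Lah polynomials are $\lambda_k(x)=\overline{l}(x,x-k)/x^{\underline{k+1}}$ (identities are between rational functions of $x$). For a formal power series $F(u)$ with constant term $1$, $F(u)^x=\exp(x\ln F(u))$. *)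

theory Defs
  imports "HOL-Computational_Algebra.Computational_Algebra"
begin

text \<open>
  Rational functions in \<open>x\<close> over an arbitrary field \<open>'a\<close> of characteristic 0 are elements of
  \<open>'a poly fract\<close>; the polynomials among them are the values of \<^const>\<open>to_fract\<close>.
\<close>

abbreviation ratX :: "'a::field_char_0 poly fract" where
  "ratX \<equiv> to_fract [:0, 1:]"

text \<open>
  This instance makes \<open>gchoose\<close> and the exponential and logarithmic series available over the
  field of rational functions.
\<close>

lemma of_nat_fract: "(of_nat n :: 'a::idom fract) = to_fract (of_nat n)"
  by (induction n) simp_all

instance fract :: ("{idom, ring_char_0}") field_char_0
  by standard (simp add: inj_on_def of_nat_fract to_fract_eq_iff)

text \<open>
  The rational function \<open>l(x, x - k) = k! binom(x, k) binom(x - 1, k)\<close>.  By \<open>lah_poly\<close> below it is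
  the polynomial whose values at \<open>x = n\<close> are the scaled Lah numbers \<open>l(n, n - k)\<close>, where
  \<open>l(n, m) = n! / m! binom(n - 1, m - 1)\<close>.
\<close>

definition lah :: "nat \<Rightarrow> 'a::field_char_0 poly fract" where
  "lah k = fact k * (ratX gchoose k) * ((ratX - 1) gchoose k)"

lemma to_fract_prod: "to_fract (\<Prod>i\<in>A. f i) = (\<Prod>i\<in>A. to_fract (f i))"
  by (induction A rule: infinite_finite_induct) simp_all

lemma fact_fract: "(fact k :: 'a::field_char_0 poly fract) = to_fract [:fact k:]"
  by (metis of_nat_fact of_nat_fract of_nat_poly)

lemma gbinomial_to_fract:
  fixes p :: "'a::field_char_0 poly"
  shows "to_fract p gchoose k = to_fract (smult (inverse (fact k)) (\<Prod>i = 0..<k. p - of_nat i))"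
    (is "_ = to_fract ?b")
proof -
  have "to_fract ?b * fact k = (\<Prod>i = 0..<k. to_fract p - of_nat i)"
    by (simp add: fact_fract of_nat_fract flip: to_fract_mult to_fract_diff to_fract_prod)
  then show ?thesis
    by (simp add: gbinomial_prod_rev divide_eq_eq)
qed

lemma lah_poly:
  "\<exists>p. lah k = to_fract (p :: 'a::field_char_0 poly) \<and>
       (\<forall>n>k. poly p (of_nat n) = fact n / fact (n - k) * of_nat ((n - 1) choose (n - k - 1)))"
proof -
  define b where "b = (\<lambda>p :: 'a poly. smult (inverse (fact k)) (\<Prod>i = 0..<k. p - of_nat i))"
  define p where "p = [:fact k:] * b [:0, 1:] * b ([:0, 1:] - 1)"
  have "to_fract [:0, 1:] - 1 = to_fract ([:0, 1:] - 1 :: 'a poly)"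
    by simp
  then have "lah k = to_fract p"
    unfolding lah_def p_def b_def
    by (simp only: fact_fract gbinomial_to_fract to_fract_mult)
  moreover have "poly p (of_nat n) = fact n / fact (n - k) * of_nat ((n - 1) choose (n - k - 1))"
    if "k < n" for n
  proof -
    have b: "poly (b q) a = poly q a gchoose k" for q a
      by (simp add: b_def gbinomial_prod_rev poly_prod divide_inverse mult.commute)
    have "of_nat n - 1 = (of_nat (n - 1) :: 'a)"
      using that by (simp add: of_nat_diff)
    then have "poly p (of_nat n) = fact k * of_nat (n choose k) * of_nat ((n - 1) choose k)"
      by (simp add: p_def b flip: binomial_gbinomial)
    also have "(n - 1) choose k = (n - 1) choose (n - k - 1)"
      using that by (subst binomial_symmetric) (auto simp: diff_commute)
    also have "fact k * of_nat (n choose k) = (fact n / fact (n - k) :: 'a)"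
      using that by (simp add: binomial_fact)
    finally show ?thesis .
  qed
  ultimately show ?thesis
    by blast
qed

text \<open>
  The falling factorial \<open>a (a - 1) \<dots> (a - k + 1)\<close>.
\<close>

definition falling_fact :: "'a::comm_ring_1 \<Rightarrow> nat \<Rightarrow> 'a" where
  "falling_fact a k = (\<Prod>i<k. a - of_nat i)"

definition lah_lambda :: "nat \<Rightarrow> 'a::field_char_0 poly fract" where
  "lah_lambda k = lah k / falling_fact ratX (k + 1)"

text \<open>
  \<open>rat_shift c r\<close> is the rational function \<open>r(x + c)\<close>.
\<close>

lemma pcompose_shift_eq_0_iff:
  "p \<circ>\<^sub>p [:c, 1:] = 0 \<longleftrightarrow> p = (0 :: 'a::field_char_0 poly)"
  by (auto simp: pcompose_eq_0_iff)

definition rat_shift :: "'a::field_char_0 \<Rightarrow> 'a poly fract \<Rightarrow> 'a poly fract" where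
  "rat_shift c r = (THE s. \<exists>p q. q \<noteq> 0 \<and> r = Fract p q \<and>
     s = Fract (p \<circ>\<^sub>p [:c, 1:]) (q \<circ>\<^sub>p [:c, 1:]))"

lemma rat_shift_Fract:
  fixes p q :: "'a::field_char_0 poly"
  assumes "q \<noteq> 0"
  shows "rat_shift c (Fract p q) = Fract (p \<circ>\<^sub>p [:c, 1:]) (q \<circ>\<^sub>p [:c, 1:])"
  unfolding rat_shift_def
proof (rule the_equality)
  fix s
  assume "\<exists>p' q'. q' \<noteq> 0 \<and> Fract p q = Fract p' q' \<and>
    s = Fract (p' \<circ>\<^sub>p [:c, 1:]) (q' \<circ>\<^sub>p [:c, 1:])"
  then obtain p' q' where q': "q' \<noteq> 0" and eq: "Fract p q = Fract p' q'"
    and s: "s = Fract (p' \<circ>\<^sub>p [:c, 1:]) (q' \<circ>\<^sub>p [:c, 1:])"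
    by blast
  have "p * q' = p' * q"
    using eq assms q' by (simp add: eq_fract)
  then have "(p \<circ>\<^sub>p [:c, 1:]) * (q' \<circ>\<^sub>p [:c, 1:]) = (p' \<circ>\<^sub>p [:c, 1:]) * (q \<circ>\<^sub>p [:c, 1:])"
    by (metis pcompose_mult)
  then show "s = Fract (p \<circ>\<^sub>p [:c, 1:]) (q \<circ>\<^sub>p [:c, 1:])"
    using assms q' by (simp add: s eq_fract pcompose_shift_eq_0_iff)
qed (use assms in blast)

text \<open>
  For \<open>F\<close> with constant term 1: \<open>ln F\<close> is the composition of \<open>fps_ln 1\<close>, the series of
  \<open>ln (1 + u)\<close>, with \<open>F - 1\<close>, and \<open>F\<^sup>a = exp (a ln F)\<close>.
\<close>

definition fps_log :: "'a::field_char_0 fps \<Rightarrow> 'a fps" where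
  "fps_log F = fps_ln 1 oo (F - 1)"

definition fps_pow :: "'a::field_char_0 fps \<Rightarrow> 'a \<Rightarrow> 'a fps" where
  "fps_pow F a = fps_exp 1 oo (fps_const a * fps_log F)"

end

theory Submission
  imports Defs
begin

text \<open>
  The falling factorial of length \<open>k + 1\<close> splits as
  \<open>x (x - 1) \<dots> (x - k) = x \<cdot> k! binom(x - 1, k)\<close>, and the second factor occurs in \<open>l(x, x - k)\<close>.
  Cancelling it leaves \<open>\<lambda>\<^sub>k(x) = binom(x, k) / x\<close> (\<open>lah_lambda_eq\<close>), so each claim becomes a
  statement about generalized binomial coefficients over the field of rational functions.
  The degree is that of a product of \<open>k\<close> linear factors, and the recurrence is Pascal's rule.

  Substituting \<open>x + c\<close> for \<open>x\<close> gives \<open>\<lambda>\<^sub>k(x + c) = binom(x + c, k) / (x + c)\<close>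
  (\<open>rat_shift_lah_lambda\<close>).  At \<open>c = k\<close> absorption removes the denominator:
  \<open>x \<lambda>\<^sub>k(x + k) = binom(x + k - 1, k) = (-1)\<^sup>k binom(-x, k)\<close>.

  Both generating functions are therefore instances of the binomial theorem for an arbitrary
  exponent \<open>a\<close>: the series \<open>exp (a ln (1 + u))\<close> has constant term 1 and solves
  \<open>(1 + u) f' = a f\<close>, which characterizes \<open>\<Sum>\<^sub>k binom(a, k) u\<^sup>k\<close>.  The first
  is the case \<open>a = x\<close>.  The second substitutes \<open>-u\<close> for \<open>u\<close> in the case \<open>a = -x\<close>, because
  \<open>1 / (1 - u)\<^sup>x = (1 - u)\<^sup>-\<^sup>x\<close> (\<open>inverse_fps_pow\<close>).
\<close>

text \<open>
  The differential equation \<open>(1 + u) f' = a f\<close> together with \<open>f(0) = 1\<close> determines the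
  binomial series.
\<close>

lemma exp_ln_eq_fps_binomial:
  fixes a :: "'a::field_char_0"
  shows "fps_exp 1 oo (fps_const a * fps_ln 1) = fps_binomial a"
proof -
  let ?f = "fps_exp 1 oo (fps_const a * fps_ln 1)"
  have "fps_deriv ?f = ?f * (fps_const a * inverse (1 + fps_X))"
    by (simp add: fps_compose_deriv fps_ln_deriv)
  also have "\<dots> = fps_const a * ?f / (1 + fps_X)"
    by (simp add: fps_divide_unit mult_ac)
  finally show ?thesis
    by (subst fps_binomial_ODE_unique' [symmetric]) simp
qed

lemma fps_pow_eq_binomial_compose:
  fixes F :: "'a::field_char_0 fps"
  assumes "F $ 0 = 1"
  shows "fps_pow F a = fps_binomial a oo (F - 1)"
proof -
  have 0: "(F - 1) $ 0 = 0"
    using assms by simp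
  have "fps_pow F a = fps_exp 1 oo ((fps_const a * fps_ln 1) oo (F - 1))"
    by (simp add: fps_pow_def fps_log_def fps_compose_mult_distrib [OF 0])
  also have "\<dots> = (fps_exp 1 oo (fps_const a * fps_ln 1)) oo (F - 1)"
    by (rule fps_compose_assoc [OF 0]) simp
  finally show ?thesis
    by (simp add: exp_ln_eq_fps_binomial)
qed

text \<open>
  The Vandermonde identity says \<open>(1 + u)\<^sup>a\<^sup>+\<^sup>b = (1 + u)\<^sup>a (1 + u)\<^sup>b\<close>; composing it
  with \<open>F - 1\<close> at \<open>b = -a\<close> gives the inverse.
\<close>

lemma inverse_fps_pow:
  fixes F :: "'a::field_char_0 fps"
  assumes "F $ 0 = 1"
  shows "inverse (fps_pow F a) = fps_pow F (- a)"
proof (rule fps_inverse_unique)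
  have 0: "(F - 1) $ 0 = 0"
    using assms by simp
  show "fps_pow F a * fps_pow F (- a) = 1"
    by (simp add: fps_pow_eq_binomial_compose [OF assms] fps_compose_1
        flip: fps_compose_mult_distrib [OF 0] fps_binomial_add_mult)
qed

lemma fps_pow_1_plus_X: "fps_pow (1 + fps_X) a = fps_binomial a"
  by (simp add: fps_pow_eq_binomial_compose)

lemma fps_pow_1_minus_X_nth: "fps_pow (1 - fps_X) a $ k = (- 1) ^ k * (a gchoose k)"
  by (simp add: fps_pow_eq_binomial_compose fps_compose_uminus')

definition binom_poly :: "'a::field_char_0 poly \<Rightarrow> nat \<Rightarrow> 'a poly" where
  "binom_poly p k = smult (inverse (fact k)) (\<Prod>i = 0..<k. p - of_nat i)"

lemma to_fract_binom_poly: "to_fract (binom_poly p k) = to_fract p gchoose k"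
  unfolding binom_poly_def by (rule gbinomial_to_fract [symmetric])

lemma of_nat_poly_compose [simp]: "of_nat n \<circ>\<^sub>p q = (of_nat n :: 'a::field_char_0 poly)"
  by (simp add: of_nat_poly)

lemma binom_poly_compose: "binom_poly p k \<circ>\<^sub>p q = binom_poly (p \<circ>\<^sub>p q) k"
  by (simp add: binom_poly_def pcompose_smult pcompose_prod pcompose_diff)

lemma degree_binom_poly: "degree (binom_poly [:a, 1:] k) = k"
proof -
  have "[:a, 1:] - of_nat i = [:a - of_nat i, 1:]" for i
    by (simp add: of_nat_poly)
  then show ?thesis
    by (simp add: binom_poly_def degree_prod_eq_sum_degree)
qed

lemma ratX_plus_const: "ratX + to_fract [:c:] = to_fract [:c, 1:]"
  by (simp flip: to_fract_add)

lemma ratX_plus_const_neq_0: "ratX + to_fract [:c:] \<noteq> 0"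
  by (simp add: ratX_plus_const del: to_fract_add)

lemma to_fract_const_of_nat: "to_fract [:of_nat k:] = of_nat k"
  by (simp add: of_nat_fract of_nat_poly)

text \<open>
  This is the factor cancelled from \<open>\<lambda>\<^sub>k\<close>.  As a polynomial of degree \<open>k\<close> it can
  only vanish for \<open>k = 0\<close>, where it is 1.
\<close>

lemma gbinomial_ratX_minus_1_neq_0: "(ratX - 1) gchoose k \<noteq> 0"
proof -
  have "[:- 1, 1:] = [:0, 1:] - (1 :: 'a poly)"
    by (simp add: one_pCons)
  then have eq: "ratX - 1 gchoose k = to_fract (binom_poly [:- 1, 1 :: 'a:] k)"
    by (simp add: to_fract_binom_poly)
  show ?thesis
  proof (cases "k = 0")
    case False
    then show ?thesis
      using degree_binom_poly [of "- 1 :: 'a" k] unfolding eq by auto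
  qed simp
qed

lemma falling_fact_Suc_eq:
  fixes a :: "'a::field_char_0"
  shows "falling_fact a (Suc k) = a * (fact k * ((a - 1) gchoose k))"
  unfolding falling_fact_def
  by (subst prod.lessThan_Suc_shift)
    (simp add: gbinomial_prod_rev atLeast0LessThan algebra_simps)

lemma lah_lambda_eq: "lah_lambda k = (ratX gchoose k :: 'a::field_char_0 poly fract) / ratX"
proof -
  have "(ratX - 1) gchoose k \<noteq> (0 :: 'a poly fract)"
    by (rule gbinomial_ratX_minus_1_neq_0)
  then show ?thesis
    by (simp add: lah_lambda_def lah_def falling_fact_Suc_eq)
qed

lemma ratX_mult_lah_lambda: "ratX * lah_lambda k = ratX gchoose k"
  by (simp add: lah_lambda_eq)

lemma rat_shift_lah_lambda:
  "rat_shift c (lah_lambda k) = ((ratX + to_fract [:c:]) gchoose k) / (ratX + to_fract [:c:])"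
proof -
  have "lah_lambda k = Fract (binom_poly [:0, 1:] k) [:0, 1 :: 'a:]"
    by (simp add: lah_lambda_eq Fract_conv_to_fract to_fract_binom_poly)
  then have "rat_shift c (lah_lambda k)
      = Fract (binom_poly [:0, 1:] k \<circ>\<^sub>p [:c, 1:]) ([:0, 1:] \<circ>\<^sub>p [:c, 1:])"
    by (simp add: rat_shift_Fract)
  also have "\<dots> = Fract (binom_poly [:c, 1:] k) [:c, 1:]"
    by (simp add: binom_poly_compose pcompose_pCons)
  finally show ?thesis
    by (simp only: Fract_conv_to_fract to_fract_binom_poly ratX_plus_const)
qed

text \<open>
  Absorption in the form \<open>(a - k) binom(a, k) = a binom(a - 1, k)\<close> at \<open>a = x + k\<close>, where
  \<open>a - k\<close> is \<open>x\<close> itself.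
\<close>

lemma ratX_mult_rat_shift_lah_lambda:
  "ratX * rat_shift (of_nat k) (lah_lambda k) = (ratX + of_nat k - 1) gchoose k"
proof -
  have "ratX + of_nat k \<noteq> (0 :: 'a poly fract)"
    using ratX_plus_const_neq_0 [of "of_nat k :: 'a"] by (simp only: to_fract_const_of_nat not_False_eq_True)
  moreover have "ratX * ((ratX + of_nat k) gchoose k)
      = (ratX + of_nat k) * ((ratX + of_nat k - 1) gchoose k :: 'a poly fract)"
    using gbinomial_absorb_comp [of "ratX + of_nat k :: 'a poly fract" k] by simp
  ultimately show ?thesis
    by (simp add: rat_shift_lah_lambda to_fract_const_of_nat)
qed

theorem proposition3p5:
  shows "(\<forall>k. ratX * lah_lambda k = (ratX gchoose k :: 'a::field_char_0 poly fract)
              \<and> (\<exists>p :: 'a poly. ratX gchoose k = to_fract p \<and> degree p = k))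
    \<and> Abs_fps (\<lambda>k. ratX * lah_lambda k) = fps_pow (1 + fps_X) (ratX :: 'a poly fract)
    \<and> (\<forall>k. \<exists>p :: 'a poly. ratX * rat_shift (of_nat k) (lah_lambda k) = to_fract p)
    \<and> Abs_fps (\<lambda>k. ratX * rat_shift (of_nat k) (lah_lambda k))
        = 1 / fps_pow (1 - fps_X) (ratX :: 'a poly fract)
    \<and> (\<forall>k\<ge>1.
          (ratX + 1) * rat_shift 1 (lah_lambda k) = ((ratX + 1) gchoose k :: 'a poly fract)
        \<and> (ratX + 1) gchoose k = (ratX gchoose (k - 1)) + (ratX gchoose k :: 'a poly fract)
        \<and> (ratX gchoose (k - 1)) + (ratX gchoose k)
            = ratX * (lah_lambda (k - 1) + lah_lambda k :: 'a poly fract))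
    \<and> ratX * lah_lambda 0 = (1 :: 'a poly fract)"
proof (intro conjI allI impI)
  fix k :: nat
  show "ratX * lah_lambda k = (ratX gchoose k :: 'a poly fract)"
    by (rule ratX_mult_lah_lambda)
  show "\<exists>p :: 'a poly. ratX gchoose k = to_fract p \<and> degree p = k"
    by (metis to_fract_binom_poly degree_binom_poly)
  have "ratX + of_nat k - 1 = to_fract ([:0, 1:] + of_nat k - 1 :: 'a poly)"
    by (simp add: of_nat_fract)
  then show "\<exists>p :: 'a poly. ratX * rat_shift (of_nat k) (lah_lambda k) = to_fract p"
    by (metis ratX_mult_rat_shift_lah_lambda to_fract_binom_poly)
next
  show "Abs_fps (\<lambda>k. ratX * lah_lambda k) = fps_pow (1 + fps_X) (ratX :: 'a poly fract)"
    by (simp add: fps_eq_iff ratX_mult_lah_lambda fps_pow_1_plus_X)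
next
  have "fps_pow (1 - fps_X) (ratX :: 'a poly fract) $ 0 \<noteq> 0"
    by (simp add: fps_pow_1_minus_X_nth)
  then have "1 / fps_pow (1 - fps_X) ratX = fps_pow (1 - fps_X) (- ratX :: 'a poly fract)"
    by (simp add: fps_divide_unit inverse_fps_pow)
  then show "Abs_fps (\<lambda>k. ratX * rat_shift (of_nat k) (lah_lambda k))
      = 1 / fps_pow (1 - fps_X) (ratX :: 'a poly fract)"
    by (simp add: fps_eq_iff ratX_mult_rat_shift_lah_lambda fps_pow_1_minus_X_nth gbinomial_minus
        flip: power_mult_distrib)
next
  fix k :: nat
  assume k: "1 \<le> k"
  have "ratX + 1 \<noteq> (0 :: 'a poly fract)"
    using ratX_plus_const_neq_0 [of "1 :: 'a"] by (simp flip: one_pCons)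
  then show "(ratX + 1) * rat_shift 1 (lah_lambda k) = ((ratX + 1) gchoose k :: 'a poly fract)"
    by (simp add: rat_shift_lah_lambda flip: one_pCons)
  show "(ratX + 1) gchoose k = (ratX gchoose (k - 1)) + (ratX gchoose k :: 'a poly fract)"
    using k by (simp add: gbinomial_reduce_nat [of k "ratX + 1"])
  show "(ratX gchoose (k - 1)) + (ratX gchoose k)
      = ratX * (lah_lambda (k - 1) + lah_lambda k :: 'a poly fract)"
    by (simp only: distrib_left ratX_mult_lah_lambda)
next
  show "ratX * lah_lambda 0 = (1 :: 'a poly fract)"
    by (simp add: ratX_mult_lah_lambda)
qed

end
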